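(* Let $q\ge 3$ be a prime power and let $X\subset\mathbb{P}^3(\mathbb{F}_q)$ be a hyperbolic quadric. The second and third weights of the code $C_2(X)$ are respectively $$w_2=q(q-1),\qquad w_3=q^2-q+1.$$
   Context: A quadric in $\mathbb{P}^3(\mathbb{F}_q)$ is the zero set $Z(f)$ of a nonzero form $f$ of degree 2 in $x_0,\dots,x_3$ over $\mathbb{F}_q$. It is non-degenerate if it has rank 4, the rank being the smallest number of indeterminates appearing in $f$ under any linear change of coordinates. A hyperbolic quadric is a non-degenerate quadric with $(q+1)^2$ points over $\mathbb{F}_q$. Let $F$ be the $\mathbb{F}_q$-vector space of forms of degree 2 in $x_0,\dots,x_3$ over $\mathbb{F}_q$ (including $0$). Each point $x\in\mathbb{P}^3(\mathbb{F}_q)$ is represented by its unique homogeneous coordinate vector whose first nonzero coordinate equals $1$. The functional code $C_2(X)$ is the image of the linear map $c:F\to\mathbb{F}_q^{|X|}$, $c(f)=(f(x_0,\dots,x_3))_{x\in X}$. The weight of a codeword is its number of nonzero coordinates. The first, second and third weights of the code are the smallest, second smallest and third smallest nonzero values taken by the weight. *)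

theory Defs
  imports "HOL-Analysis.Analysis" "HOL-Library.Poly_Mapping"
begin

text \<open>
  Polynomials in the indeterminates \<open>x\<^sub>0, \<dots>, x\<^sub>3\<close> are finitely supported functions from exponent
  vectors to coefficients, with the ring structure of \<open>Poly_Mapping\<close>.  The four indeterminates
  are indexed by the type \<open>4\<close>, whose elements are ordered \<open>0 < 1 < 2 < 3\<close>.
\<close>

type_synonym 'a poly4 = "(4 \<Rightarrow>\<^sub>0 nat) \<Rightarrow>\<^sub>0 'a"

definition forms2 :: "('a::zero) poly4 set" where
  "forms2 = {f. \<forall>m\<in>Poly_Mapping.keys f. (\<Sum>i\<in>UNIV. Poly_Mapping.lookup m i) = 2}"

definition peval :: "('a::comm_semiring_1) poly4 \<Rightarrow> 'a ^ 4 \<Rightarrow> 'a" where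
  "peval f v = (\<Sum>m\<in>Poly_Mapping.keys f.
     Poly_Mapping.lookup f m * (\<Prod>i\<in>UNIV. (v $ i) ^ Poly_Mapping.lookup m i))"

definition linear_form :: "('a::comm_semiring_1) ^ 4 \<Rightarrow> 'a poly4" where
  "linear_form a = (\<Sum>j\<in>UNIV. Poly_Mapping.single (Poly_Mapping.single j 1) (a $ j))"

text \<open>Substitution of the linear form with coefficients \<open>A $ i\<close> (row \<open>i\<close>) for \<open>x\<^sub>i\<close>.\<close>

definition lin_subst :: "'a ^ 4 ^ 4 \<Rightarrow> ('a::comm_semiring_1) poly4 \<Rightarrow> 'a poly4" where
  "lin_subst A f = (\<Sum>m\<in>Poly_Mapping.keys f.
     Poly_Mapping.single 0 (Poly_Mapping.lookup f m) *
     (\<Prod>i\<in>UNIV. linear_form (A $ i) ^ Poly_Mapping.lookup m i))"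

definition indets :: "('a::zero) poly4 \<Rightarrow> 4 set" where
  "indets f = (\<Union>m\<in>Poly_Mapping.keys f. Poly_Mapping.keys m)"

definition form_rank :: "('a::field) poly4 \<Rightarrow> nat" where
  "form_rank f = (LEAST r. \<exists>A. invertible A \<and> card (indets (lin_subst A f)) = r)"

text \<open>
  A point of the projective space is identified with its unique homogeneous coordinate vector
  whose first nonzero coordinate is \<open>1\<close>; see \<open>pg3_unique_representative\<close>.
\<close>

definition pg3 :: "(('a::field) ^ 4) set" where
  "pg3 = {x. \<exists>i. x $ i = 1 \<and> (\<forall>j<i. x $ j = 0)}"

lemma pg3_unique_representative:
  fixes v :: "('a::field) ^ 4"
  assumes "v \<noteq> 0"
  shows "\<exists>!x. x \<in> pg3 \<and> (\<exists>c. c \<noteq> 0 \<and> v = c *s x)"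
proof -
  have "{i. v $ i \<noteq> 0} \<noteq> {}"
    using assms by (auto simp: vec_eq_iff)
  define i where "i = Min {i. v $ i \<noteq> 0}"
  have i: "v $ i \<noteq> 0"
    using Min_in[OF _ \<open>{i. v $ i \<noteq> 0} \<noteq> {}\<close>] by (simp add: i_def)
  have less: "v $ j = 0" if "j < i" for j
  proof (rule ccontr)
    assume "v $ j \<noteq> 0"
    then have "i \<le> j"
      unfolding i_def by (intro Min_le) auto
    with that show False
      by simp
  qed
  show ?thesis
  proof (rule ex1I[of _ "inverse (v $ i) *s v"])
    show "inverse (v $ i) *s v \<in> pg3 \<and> (\<exists>c. c \<noteq> 0 \<and> v = c *s (inverse (v $ i) *s v))"
      using i less by (auto simp: pg3_def vec_eq_iff intro!: exI[of _ i] exI[of _ "v $ i"])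
  next
    fix x assume "x \<in> pg3 \<and> (\<exists>c. c \<noteq> 0 \<and> v = c *s x)"
    then obtain c k where c: "c \<noteq> 0" "v = c *s x" and k: "x $ k = 1" "\<forall>j<k. x $ j = 0"
      by (auto simp: pg3_def)
    have "k = i"
      using i less[of k] c k by (cases k i rule: linorder_cases) auto
    then show "x = inverse (v $ i) *s v"
      using c k by (simp add: vec_eq_iff)
  qed
qed

definition zero_set :: "('a::field) poly4 \<Rightarrow> ('a ^ 4) set" where
  "zero_set f = {x \<in> pg3. peval f x = 0}"

definition hyperbolic_quadric :: "(('a::{field,finite}) ^ 4) set \<Rightarrow> bool" where
  "hyperbolic_quadric X \<longleftrightarrow>
     (\<exists>f\<in>forms2. f \<noteq> 0 \<and> form_rank f = 4 \<and> X = zero_set f) \<and> card X = (CARD('a) + 1)\<^sup>2"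

text \<open>Words of length \<open>|X|\<close> are elements of \<open>X \<rightarrow>\<^sub>E UNIV\<close>, i.e. coordinates are indexed by \<open>X\<close>.\<close>

definition functional_code2 :: "(('a::field) ^ 4) set \<Rightarrow> ('a ^ 4 \<Rightarrow> 'a) set" where
  "functional_code2 X = (\<lambda>f. restrict (peval f) X) ` forms2"

definition word_weight :: "(('a::field) ^ 4) set \<Rightarrow> ('a ^ 4 \<Rightarrow> 'a) \<Rightarrow> nat" where
  "word_weight X c = card {x \<in> X. c x \<noteq> 0}"

definition code_weights :: "(('a::field) ^ 4) set \<Rightarrow> nat set" where
  "code_weights X = word_weight X ` functional_code2 X - {0}"

text \<open>\<open>w\<close> is the \<open>k\<close>-th smallest nonzero weight (counting from \<open>k = 1\<close>): it is attained and exactly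
  \<open>k - 1\<close> nonzero weights are smaller.\<close>

definition is_kth_weight :: "(('a::field) ^ 4) set \<Rightarrow> nat \<Rightarrow> nat \<Rightarrow> bool" where
  "is_kth_weight X k w \<longleftrightarrow>
     w \<in> code_weights X \<and> Suc (card {v \<in> code_weights X. v < w}) = k"

end

theory Submission
  imports Defs
begin

text \<open>
  Over \<open>F\<^sub>q\<close> a non-degenerate quadratic form in four variables splits off a hyperbolic plane as soon as
  it has a zero, and \<open>(q + 1)\<^sup>2\<close> projective zeros are too many for an anisotropic complement. So a hyperbolic
  quadric is projectively \<open>x\<^sub>0 x\<^sub>3 = x\<^sub>1 x\<^sub>2\<close>, the image of the Segre embedding of
  \<open>P\<^sup>1 \<times> P\<^sup>1\<close>, on which quadratic forms restrict to forms of bidegree \<open>(2, 2)\<close>. A row or column of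
  this \<open>(q + 1) \<times> (q + 1)\<close> grid with three zeros consists of zeros. Counting by the number of full rows,
  such a form vanishes identically, or at exactly \<open>4 q\<close> points, or at no more than \<open>3 q + 1\<close> points.
  The counts \<open>4 q\<close>, \<open>3 q + 1\<close> and \<open>3 q\<close> are attained by \<open>x\<^sub>0 x\<^sub>3\<close>, \<open>x\<^sub>0 x\<^sub>2\<close> and
  \<open>x\<^sub>1 (x\<^sub>1 - x\<^sub>2)\<close>.
\<close>

section \<open>Quadratic forms\<close>

definition total_degree :: "(4 \<Rightarrow>\<^sub>0 nat) \<Rightarrow> nat" where
  "total_degree m = (\<Sum>i\<in>UNIV. Poly_Mapping.lookup m i)"

definition monom_val :: "(4 \<Rightarrow>\<^sub>0 nat) \<Rightarrow> 'a::comm_semiring_1 ^ 4 \<Rightarrow> 'a" where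
  "monom_val m v = (\<Prod>i\<in>UNIV. (v $ i) ^ Poly_Mapping.lookup m i)"

definition homogeneous :: "nat \<Rightarrow> 'a::zero poly4 \<Rightarrow> bool" where
  "homogeneous d f \<longleftrightarrow> (\<forall>m\<in>Poly_Mapping.keys f. total_degree m = d)"

lemma forms2_iff_homogeneous: "f \<in> forms2 \<longleftrightarrow> homogeneous 2 f"
  by (simp add: forms2_def homogeneous_def total_degree_def)

lemma total_degree_add: "total_degree (m + n) = total_degree m + total_degree n"
  by (simp add: total_degree_def lookup_add sum.distrib)

lemma total_degree_single [simp]: "total_degree (Poly_Mapping.single i k) = k"
  by (simp add: total_degree_def lookup_single when_def)

lemma total_degree_eq_0D: "total_degree m = 0 \<Longrightarrow> m = 0"
  by (auto simp: total_degree_def intro!: poly_mapping_eqI)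

lemma total_degree_eq_SucD:
  assumes "total_degree m = Suc d"
  obtains i n where "m = Poly_Mapping.single i 1 + n" "total_degree n = d"
proof -
  obtain i where i: "Poly_Mapping.lookup m i \<noteq> 0"
    using assms by (metis nat.distinct(1) sum.neutral total_degree_def)
  have eq: "m = Poly_Mapping.single i 1 + (m - Poly_Mapping.single i 1)"
    using i by (intro poly_mapping_eqI) (auto simp: lookup_add lookup_minus lookup_single when_def)
  then have "total_degree m = 1 + total_degree (m - Poly_Mapping.single i 1)"
    by (metis total_degree_add total_degree_single)
  with eq assms that show ?thesis
    by simp
qed

lemma total_degree_eq_2D:
  assumes "total_degree m = 2"
  obtains i j where "m = Poly_Mapping.single i 1 + Poly_Mapping.single j 1"
proof -
  have "total_degree m = Suc (Suc 0)"
    using assms by simp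
  then obtain i n where n: "m = Poly_Mapping.single i 1 + n" "total_degree n = Suc 0"
    by (rule total_degree_eq_SucD)
  from n(2) obtain j k where k: "n = Poly_Mapping.single j 1 + k" "total_degree k = 0"
    by (rule total_degree_eq_SucD)
  from total_degree_eq_0D[OF k(2)] n(1) k(1) that show ?thesis
    by simp
qed

lemma homogeneous_add: "homogeneous d f \<Longrightarrow> homogeneous d g \<Longrightarrow> homogeneous d (f + g)"
  using Poly_Mapping.keys_add[of f g] by (fastforce simp: homogeneous_def)

lemma homogeneous_sum: "(\<And>x. x \<in> S \<Longrightarrow> homogeneous d (f x)) \<Longrightarrow> homogeneous d (sum f S)"
  by (induction S rule: infinite_finite_induct) (auto intro: homogeneous_add simp: homogeneous_def[of _ 0])

lemma homogeneous_single: "total_degree m = d \<Longrightarrow> homogeneous d (Poly_Mapping.single m c)"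
  by (simp add: homogeneous_def)

lemma homogeneous_mult:
  fixes f g :: "'a::comm_semiring_1 poly4"
  assumes "homogeneous d f" "homogeneous e g"
  shows "homogeneous (d + e) (f * g)"
  using assms keys_mult[of f g] by (fastforce simp: homogeneous_def total_degree_add)

lemma homogeneous_one: "homogeneous 0 (1 :: 'a::comm_semiring_1 poly4)"
  by (simp add: homogeneous_def total_degree_def)

lemma homogeneous_power:
  fixes f :: "'a::comm_semiring_1 poly4"
  shows "homogeneous d f \<Longrightarrow> homogeneous (d * n) (f ^ n)"
  by (induction n) (auto intro: homogeneous_mult homogeneous_one)

lemma homogeneous_prod:
  fixes f :: "'b \<Rightarrow> 'a::comm_semiring_1 poly4"
  shows "(\<And>x. x \<in> S \<Longrightarrow> homogeneous (d x) (f x)) \<Longrightarrow> homogeneous (sum d S) (prod f S)"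
  by (induction S rule: infinite_finite_induct) (auto intro: homogeneous_mult homogeneous_one)

text \<open>Each monomial of degree \<open>d\<close> turns into a constant times a product of
  \<open>d\<close> linear forms.\<close>

lemma homogeneous_lin_subst:
  fixes f :: "'a::comm_semiring_1 poly4"
  assumes "homogeneous d f"
  shows "homogeneous d (lin_subst A f)"
  unfolding lin_subst_def
proof (rule homogeneous_sum)
  fix m assume "m \<in> Poly_Mapping.keys f"
  \<comment> \<open>Degree 0 for the constant coefficient and degree 1 for each linear form, in the
    shape that the product rules produce.\<close>
  then have d: "d = 0 + (\<Sum>i\<in>UNIV. 1 * Poly_Mapping.lookup m i)"
    using assms by (simp add: homogeneous_def total_degree_def)
  show "homogeneous d (Poly_Mapping.single 0 (Poly_Mapping.lookup f m) *
          (\<Prod>i\<in>UNIV. linear_form (A $ i) ^ Poly_Mapping.lookup m i))"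
    unfolding d linear_form_def
    by (intro homogeneous_mult homogeneous_prod homogeneous_power homogeneous_single
        homogeneous_sum total_degree_single) (simp add: total_degree_def)
qed

section \<open>Evaluation as a ring homomorphism\<close>

lemma monom_val_add: "monom_val (m + n) v = monom_val m v * monom_val n v"
  by (simp add: monom_val_def lookup_add power_add prod.distrib)

lemma monom_val_zero [simp]: "monom_val 0 v = 1"
  by (simp add: monom_val_def)

lemma monom_val_single [simp]: "monom_val (Poly_Mapping.single i k) v = v $ i ^ k"
proof -
  have "monom_val (Poly_Mapping.single i k) v = (\<Prod>j\<in>UNIV. if j = i then v $ i ^ k else 1)"
    unfolding monom_val_def by (intro prod.cong) (auto simp: lookup_single when_def)
  then show ?thesis
    by simp
qed

lemma peval_altdef:
  "peval f v = (\<Sum>m\<in>Poly_Mapping.keys f. Poly_Mapping.lookup f m * monom_val m v)"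
  by (simp add: peval_def monom_val_def)

lemma peval_superset:
  assumes "finite S" "Poly_Mapping.keys f \<subseteq> S"
  shows "peval f v = (\<Sum>m\<in>S. Poly_Mapping.lookup f m * monom_val m v)"
  unfolding peval_altdef using assms
  by (intro sum.mono_neutral_left) (auto simp: in_keys_iff)

lemma peval_add: "peval (f + g) v = peval f v + peval g v"
proof -
  let ?S = "Poly_Mapping.keys f \<union> Poly_Mapping.keys g"
  have "Poly_Mapping.keys (f + g) \<subseteq> ?S"
    by (rule Poly_Mapping.keys_add)
  then show ?thesis
    by (simp add: peval_superset[of ?S] lookup_add algebra_simps sum.distrib)
qed

lemma peval_zero [simp]: "peval 0 v = 0"
  by (simp add: peval_def)

lemma peval_single [simp]: "peval (Poly_Mapping.single m c) v = c * monom_val m v"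
  by (simp add: peval_altdef)

lemma peval_sum: "peval (sum f S) v = (\<Sum>x\<in>S. peval (f x) v)"
  by (induction S rule: infinite_finite_induct) (auto simp: peval_add)

lemma peval_one [simp]: "peval 1 v = 1"
  using peval_single[of 0 1 v] by simp

lemma sum_single: "f = (\<Sum>m\<in>Poly_Mapping.keys f. Poly_Mapping.single m (Poly_Mapping.lookup f m))"
  by (intro poly_mapping_eqI)
    (auto simp: lookup_sum lookup_single when_def in_keys_iff sum.delta)

text \<open>Expanding both factors into monomials reduces the claim to
  \<open>monom_val_add\<close>.\<close>

lemma peval_mult:
  fixes f g :: "'a::comm_semiring_1 poly4"
  shows "peval (f * g) v = peval f v * peval g v"
proof -
  have "f * g = (\<Sum>m\<in>Poly_Mapping.keys f. \<Sum>n\<in>Poly_Mapping.keys g.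
      Poly_Mapping.single (m + n) (Poly_Mapping.lookup f m * Poly_Mapping.lookup g n))"
    by (subst (1 2) sum_single) (simp add: sum_product mult_single)
  then have "peval (f * g) v = (\<Sum>m\<in>Poly_Mapping.keys f. \<Sum>n\<in>Poly_Mapping.keys g.
      (Poly_Mapping.lookup f m * monom_val m v) * (Poly_Mapping.lookup g n * monom_val n v))"
    by (simp add: peval_sum monom_val_add mult_ac)
  then show ?thesis
    by (simp add: peval_altdef sum_product)
qed

lemma peval_power:
  fixes f :: "'a::comm_semiring_1 poly4"
  shows "peval (f ^ n) v = peval f v ^ n"
  by (induction n) (simp_all add: peval_mult)

lemma peval_prod:
  fixes f :: "'b \<Rightarrow> 'a::comm_semiring_1 poly4"
  shows "peval (prod f S) v = (\<Prod>x\<in>S. peval (f x) v)"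
  by (induction S rule: infinite_finite_induct) (auto simp: peval_mult)

text \<open>The rows of \<open>A\<close> are the substituted forms, so no transpose appears. A
  change of the form is thereby exchanged for a change of the point.\<close>

lemma peval_lin_subst: "peval (lin_subst A f) v = peval f (A *v v)"
  by (simp add: lin_subst_def peval_sum peval_mult peval_prod peval_power linear_form_def
      peval_altdef[of f] monom_val_def[of _ "\<chi> i. \<Sum>j\<in>UNIV. A $ i $ j * v $ j"]
      matrix_vector_mult_def)

section \<open>The polar bilinear form, in every characteristic\<close>

definition polar :: "'a::comm_ring_1 poly4 \<Rightarrow> 'a ^ 4 \<Rightarrow> 'a ^ 4 \<Rightarrow> 'a" where
  "polar f x y = peval f (x + y) - peval f x - peval f y"

lemma forms2_monomials:
  assumes "f \<in> forms2"
  obtains i j where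
    "\<And>m. m \<in> Poly_Mapping.keys f \<Longrightarrow> m = Poly_Mapping.single (i m) 1 + Poly_Mapping.single (j m) 1"
proof -
  have "\<forall>m\<in>Poly_Mapping.keys f. \<exists>i j. m = Poly_Mapping.single i 1 + Poly_Mapping.single j 1"
    using assms unfolding forms2_iff_homogeneous homogeneous_def by (metis total_degree_eq_2D)
  then show ?thesis
    using that by metis
qed

lemma monom_val_pair:
  "m = Poly_Mapping.single i 1 + Poly_Mapping.single j 1 \<Longrightarrow> monom_val m v = v $ i * v $ j"
  by (simp add: monom_val_add)

text \<open>A monomial of degree 2 is a product of two coordinates, possibly equal; which of them is
  called \<open>i m\<close> is arbitrary. With values and polar values as explicit sums, scaling and
  bilinearity are checked termwise, without division by 2.\<close>

lemma forms2_expansion: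
  fixes f :: "'a::comm_ring_1 poly4"
  assumes "f \<in> forms2"
  obtains S c i j where "finite (S :: (4 \<Rightarrow>\<^sub>0 nat) set)"
    "\<And>v. peval f v = (\<Sum>m\<in>S. c m * (v $ i m * v $ j m))"
    "\<And>x y. polar f x y = (\<Sum>m\<in>S. c m * (x $ i m * y $ j m + y $ i m * x $ j m))"
proof -
  obtain i j where ij:
    "\<And>m. m \<in> Poly_Mapping.keys f \<Longrightarrow> m = Poly_Mapping.single (i m) 1 + Poly_Mapping.single (j m) 1"
    using forms2_monomials[OF assms] by blast
  have ev: "peval f v = (\<Sum>m\<in>Poly_Mapping.keys f. Poly_Mapping.lookup f m * (v $ i m * v $ j m))" for v
    unfolding peval_altdef by (intro sum.cong refl arg_cong2[where f = times] monom_val_pair ij)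
  show ?thesis
  proof (rule that[OF finite_keys ev])
    show "polar f x y = (\<Sum>m\<in>Poly_Mapping.keys f. Poly_Mapping.lookup f m * (x $ i m * y $ j m + y $ i m * x $ j m))" for x y
      unfolding polar_def ev by (simp add: sum_subtractf[symmetric] algebra_simps)
  qed
qed

lemma peval_scale:
  fixes f :: "'a::comm_ring_1 poly4"
  assumes "f \<in> forms2"
  shows "peval f (a *s x) = a\<^sup>2 * peval f x"
  by (rule forms2_expansion[OF assms]) (simp add: sum_distrib_left power2_eq_square mult_ac)

lemma polar_commute: "polar f x y = polar f y x"
  by (simp add: polar_def add.commute)

lemma polar_add:
  fixes f :: "'a::comm_ring_1 poly4"
  assumes "f \<in> forms2"
  shows "polar f (x + x') y = polar f x y + polar f x' y"
  by (rule forms2_expansion[OF assms]) (simp add: sum.distrib[symmetric] algebra_simps)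

lemma polar_scale:
  fixes f :: "'a::comm_ring_1 poly4"
  assumes "f \<in> forms2"
  shows "polar f (a *s x) y = a * polar f x y"
  by (rule forms2_expansion[OF assms]) (simp add: sum_distrib_left algebra_simps)

lemma polar_add_right:
  fixes f :: "'a::comm_ring_1 poly4"
  assumes "f \<in> forms2"
  shows "polar f y (x + x') = polar f y x + polar f y x'"
  using polar_add[OF assms] by (simp add: polar_commute)

lemma polar_scale_right:
  fixes f :: "'a::comm_ring_1 poly4"
  assumes "f \<in> forms2"
  shows "polar f y (a *s x) = a * polar f y x"
  using polar_scale[OF assms] by (simp add: polar_commute)

lemma polar_self:
  fixes f :: "'a::comm_ring_1 poly4"
  assumes "f \<in> forms2"
  shows "polar f x x = 2 * peval f x"
  by (rule forms2_expansion[OF assms]) (simp add: sum_distrib_left mult_ac)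

lemma peval_combination:
  fixes f :: "'a::comm_ring_1 poly4"
  assumes "f \<in> forms2"
  shows "peval f (a *s x + b *s y) = a\<^sup>2 * peval f x + a * b * polar f x y + b\<^sup>2 * peval f y"
proof -
  have "peval f (a *s x + b *s y) = polar f (a *s x) (b *s y) + peval f (a *s x) + peval f (b *s y)"
    by (simp add: polar_def)
  then show ?thesis
    using assms by (simp add: polar_scale polar_scale_right peval_scale)
qed

section \<open>Coefficients recovered from values, and the radical of a form of rank 4\<close>

lemma pair_eq_iff:
  fixes i j k l :: 4
  shows "Poly_Mapping.single i (1::nat) + Poly_Mapping.single j 1
      = Poly_Mapping.single k 1 + Poly_Mapping.single l 1
    \<longleftrightarrow> (i = k \<and> j = l) \<or> (i = l \<and> j = k)"
proof
  assume eq: "Poly_Mapping.single i (1::nat) + Poly_Mapping.single j 1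
      = Poly_Mapping.single k 1 + Poly_Mapping.single l 1"
  have "Poly_Mapping.lookup (Poly_Mapping.single i (1::nat) + Poly_Mapping.single j 1) n
      = Poly_Mapping.lookup (Poly_Mapping.single k 1 + Poly_Mapping.single l 1) n" for n
    using eq by simp
  from this[of i] this[of j] this[of k] this[of l] show "(i = k \<and> j = l) \<or> (i = l \<and> j = k)"
    by (auto simp: lookup_add lookup_single when_def split: if_splits)
qed (auto simp: add.commute)

text \<open>At these basis vectors every monomial other than \<open>x_k x_l\<close> contributes
  zero. Vanishing values thus become vanishing coefficients, which is how an indeterminate is shown
  to be absent.\<close>

lemma lookup_eq_polar:
  fixes g :: "'a::comm_ring_1 poly4"
  assumes "g \<in> forms2"
  shows "Poly_Mapping.lookup g (Poly_Mapping.single k 1 + Poly_Mapping.single l 1)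
    = (if k = l then peval g (axis k 1) else polar g (axis k 1) (axis l 1))"
proof -
  let ?m = "Poly_Mapping.single k 1 + Poly_Mapping.single l (1::nat)"
  let ?S = "Poly_Mapping.keys g"
  obtain i j where ij: "\<And>m. m \<in> ?S \<Longrightarrow> m = Poly_Mapping.single (i m) 1 + Poly_Mapping.single (j m) 1"
    using forms2_monomials[OF assms] by blast
  have iff: "m = ?m \<longleftrightarrow> (i m = k \<and> j m = l) \<or> (i m = l \<and> j m = k)" if "m \<in> ?S" for m
    using ij[OF that] pair_eq_iff[of "i m" "j m" k l] by simp
  have ev: "peval g v = (\<Sum>m\<in>?S. Poly_Mapping.lookup g m * (v $ i m * v $ j m))" for v
    unfolding peval_altdef by (intro sum.cong refl arg_cong2[where f = times] monom_val_pair ij)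
  have l: "Poly_Mapping.lookup g ?m = (\<Sum>m\<in>?S. if m = ?m then Poly_Mapping.lookup g m else 0)"
    by (simp add: sum.delta in_keys_iff)
  show ?thesis
  proof (cases "k = l")
    case True
    then show ?thesis
      unfolding l ev if_P[OF True]
      by (intro sum.cong refl) (subst iff, auto simp: axis_def)
  next
    case False
    then show ?thesis
      unfolding l ev polar_def sum_subtractf[symmetric] if_not_P[OF False]
      by (intro sum.cong refl) (subst iff, auto simp: axis_def)
  qed
qed

lemma invertible_if_injective:
  fixes A :: "'a::field ^ 'n ^ 'n"
  assumes "\<And>x. A *v x = 0 \<Longrightarrow> x = 0"
  shows "invertible A"
  using assms by (simp add: invertible_left_inverse matrix_left_invertible_ker)

text \<open>If a zero \<open>w\<close> of \<open>f\<close> lies in the radical of the polar form, then in coordinates with \<open>w\<close> as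
  \<open>k\<close>-th basis vector no monomial of \<open>f\<close> contains \<open>x\<^sub>k\<close>.\<close>

lemma form_rank_4_radical:
  fixes f :: "'a::field poly4"
  assumes "f \<in> forms2" "form_rank f = 4" "w \<noteq> 0" "peval f w = 0"
  obtains x where "polar f w x \<noteq> 0"
proof (rule ccontr)
  assume "\<not> thesis"
  with that have rad: "polar f w x = 0" for x
    by blast
  obtain k where k: "w $ k \<noteq> 0"
    using \<open>w \<noteq> 0\<close> by (auto simp: vec_eq_iff)
  \<comment> \<open>The identity with column \<open>k\<close> replaced by \<open>w\<close>; it is
    invertible because \<open>w $ k\<close> is nonzero.\<close>
  define A :: "'a ^ 4 ^ 4" where "A = (\<chi> i j. if j = k then w $ i else if i = j then 1 else 0)"
  have Ax: "(A *v x) $ i = (if i = k then w $ k * x $ k else x $ i + w $ i * x $ k)" for x i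
  proof -
    have "(A *v x) $ i = (\<Sum>j\<in>UNIV. if j = k then w $ i * x $ k else if j = i then x $ j else 0)"
      unfolding matrix_vector_mult_def A_def by (auto intro!: sum.cong)
    also have "\<dots> = w $ i * x $ k + (\<Sum>j\<in>UNIV - {k}. if j = i then x $ j else 0)"
      by (subst sum.remove[of _ k]) (auto intro!: sum.cong)
    finally show ?thesis
      by (auto simp: sum.delta)
  qed
  have "invertible A"
  proof (rule invertible_if_injective)
    fix x assume "A *v x = 0"
    then have *: "(A *v x) $ i = 0" for i
      by simp
    from *[of k] k have "x $ k = 0"
      by (simp add: Ax)
    then have "x $ i = 0" for i
      using *[of i] by (simp add: Ax split: if_splits)
    then show "x = 0"
      by (simp add: vec_eq_iff)
  qed
  have Ak: "A *v axis k 1 = w"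
    by (auto simp: vec_eq_iff Ax axis_def)
  define g where "g = lin_subst A f"
  have g: "g \<in> forms2"
    using assms(1) by (simp add: g_def forms2_iff_homogeneous homogeneous_lin_subst)
  have "k \<notin> indets g"
  proof
    assume "k \<in> indets g"
    then obtain m where m: "m \<in> Poly_Mapping.keys g" "k \<in> Poly_Mapping.keys m"
      by (auto simp: indets_def)
    obtain i j where "m = Poly_Mapping.single i 1 + Poly_Mapping.single j 1"
      using m(1) g total_degree_eq_2D by (metis forms2_iff_homogeneous homogeneous_def)
    moreover from this m(2) have "k = i \<or> k = j"
      by (auto simp: in_keys_iff lookup_add lookup_single when_def split: if_splits)
    ultimately obtain l where l: "m = Poly_Mapping.single k 1 + Poly_Mapping.single l 1"
      by (metis add.commute)
    have "polar g (axis k 1) (axis l 1) = polar f w (A *v axis l 1)"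
      by (simp add: polar_def g_def peval_lin_subst matrix_vector_right_distrib Ak)
    moreover have "peval g (axis k 1) = 0"
      by (simp add: g_def peval_lin_subst Ak assms)
    \<comment> \<open>The coefficient of the square of \<open>x_k\<close> is
      \<open>peval f w\<close>, and every mixed one is a polar value at \<open>w\<close>; both
      vanish.\<close>
    ultimately have "Poly_Mapping.lookup g m = 0"
      using lookup_eq_polar[OF g, of k l] unfolding l by (cases "k = l") (auto simp: rad)
    with m(1) show False
      by (simp add: in_keys_iff)
  qed
  \<comment> \<open>At most three indeterminates remain, which bounds the minimum defining the rank
    by 3.\<close>
  then have "card (indets g) \<le> card (UNIV - {k})"
    by (intro card_mono) auto
  then have "card (indets g) \<le> 3"
    by simp
  moreover have "form_rank f \<le> card (indets g)"
    unfolding form_rank_def g_def by (rule Least_le) (use \<open>invertible A\<close> in blast)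
  ultimately show False
    using assms(2) by simp
qed

section \<open>Hyperbolic quadrics\<close>

text \<open>Each nonzero vector is a unique nonzero multiple of a normalised one. Counting vectors
  instead of points makes invertible matrices act as bijections, although they do not preserve the
  normalisation.\<close>

lemma pg3_cone_card:
  fixes P :: "('a::{field,finite}) ^ 4 \<Rightarrow> bool"
  assumes "\<And>c x. c \<noteq> 0 \<Longrightarrow> P (c *s x) \<longleftrightarrow> P x"
  shows "card {v. v \<noteq> 0 \<and> P v} = (CARD('a) - 1) * card {x \<in> pg3. P x}"
proof -
  have nz: "x \<noteq> 0" if "x \<in> pg3" for x :: "'a ^ 4"
    using that by (auto simp: pg3_def)
  have "bij_betw (\<lambda>(c, x). c *s x) ((UNIV - {0 :: 'a}) \<times> {x \<in> pg3. P x}) {v. v \<noteq> 0 \<and> P v}"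
    unfolding bij_betw_def
  proof
    show "inj_on (\<lambda>(c, x). c *s x) ((UNIV - {0 :: 'a}) \<times> {x \<in> pg3. P x})"
    proof (rule inj_onI)
      fix p p' :: "'a \<times> ('a ^ 4)"
      assume asm: "p \<in> (UNIV - {0}) \<times> {x \<in> pg3. P x}" "p' \<in> (UNIV - {0}) \<times> {x \<in> pg3. P x}"
        "(\<lambda>(c, x). c *s x) p = (\<lambda>(c, x). c *s x) p'"
      obtain c x d y where p: "p = (c, x)" "p' = (d, y)"
        by (cases p; cases p')
      from asm have *: "c \<noteq> 0" "d \<noteq> 0" "x \<in> pg3" "y \<in> pg3" "c *s x = d *s y"
        by (auto simp: p)
      then have "c *s x \<noteq> 0"
        using nz by simp
      from pg3_unique_representative[OF this] * have "x = y"
        by metis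
      moreover from this * nz[of x] have "c = d"
        by (auto simp: vec_eq_iff)
      ultimately show "p = p'"
        by (simp add: p)
    qed
    show "(\<lambda>(c, x). c *s x) ` ((UNIV - {0 :: 'a}) \<times> {x \<in> pg3. P x}) = {v. v \<noteq> 0 \<and> P v}"
    proof (intro equalityI subsetI)
      fix v assume "v \<in> {v. v \<noteq> 0 \<and> P v}"
      then have v: "v \<noteq> 0" "P v"
        by auto
      then obtain x c where "x \<in> pg3" "c \<noteq> 0" "v = c *s x"
        using pg3_unique_representative by metis
      with v assms[of c x] show "v \<in> (\<lambda>(c, x). c *s x) ` ((UNIV - {0 :: 'a}) \<times> {x \<in> pg3. P x})"
        by (auto intro!: rev_image_eqI[of "(c, x)"])
    qed (use assms nz in auto)
  qed
  then have "card {v. v \<noteq> 0 \<and> P v} = card ((UNIV - {0 :: 'a}) \<times> {x \<in> pg3. P x})"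
    by (simp add: bij_betw_same_card)
  then show ?thesis
    by (simp add: card_cartesian_product)
qed

text \<open>Scaling \<open>u\<close> makes its pairing with \<open>v\<close> equal to 1. Adding a
  multiple of \<open>v\<close> then cancels the value of the form without changing that pairing, as
  \<open>polar f v v = 2 * peval f v = 0\<close>.\<close>

lemma hyperbolic_partner:
  fixes f :: "'a::field poly4"
  assumes f: "f \<in> forms2" and v: "peval f v = 0" "polar f v u \<noteq> 0"
  obtains c d where "peval f (c *s u + d *s v) = 0" "polar f v (c *s u + d *s v) = 1"
proof -
  define c where "c = inverse (polar f v u)"
  have c: "c * polar f v u = 1"
    using v by (simp add: c_def)
  define d where "d = - (c\<^sup>2 * peval f u)"
  have "peval f (c *s u + d *s v) = c\<^sup>2 * peval f u + d * (c * polar f v u)"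
    using v by (simp add: peval_combination[OF f] polar_commute[of f u v] mult_ac)
  moreover have "polar f v (c *s u + d *s v) = 1"
    using c v by (simp add: polar_add_right[OF f] polar_scale_right[OF f] polar_self[OF f])
  ultimately show ?thesis
    using that[of c d] by (simp add: d_def c)
qed

text \<open>The vectors \<open>v\<close> and \<open>w\<close> are dual to each other under the polar
  form: the coefficient of either is the pairing with the other, and \<open>y\<close> is the
  orthogonal remainder.\<close>

lemma hyperbolic_decomposition:
  fixes f :: "'a::field poly4"
  assumes f: "f \<in> forms2" and vw: "peval f v = 0" "peval f w = 0" "polar f v w = 1"
  obtains y where "x = polar f x w *s v + polar f x v *s w + y"
    "polar f v y = 0" "polar f w y = 0"
proof (rule that[of "x + (- polar f x w) *s v + (- polar f x v) *s w"])
  let ?y = "x + (- polar f x w) *s v + (- polar f x v) *s w"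
  show "x = polar f x w *s v + polar f x v *s w + ?y"
    by (simp add: vec_eq_iff)
  show "polar f v ?y = 0" "polar f w ?y = 0"
    using vw unfolding polar_add_right[OF f] polar_scale_right[OF f] polar_self[OF f]
      polar_commute[of f w v] polar_commute[of f x v] polar_commute[of f x w]
    by simp_all
qed

lemma peval_hyperbolic_sum:
  fixes f :: "'a::field poly4"
  assumes f: "f \<in> forms2" and vw: "peval f v = 0" "peval f w = 0" "polar f v w = 1"
    and y: "polar f v y = 0" "polar f w y = 0"
  shows "peval f (a *s v + b *s w + y) = a * b + peval f y"
proof -
  have "peval f (a *s v + b *s w + y)
      = polar f (a *s v + b *s w) y + peval f (a *s v + b *s w) + peval f y"
    by (simp add: polar_def)
  then show ?thesis
    using vw y by (simp add: polar_add[OF f] polar_scale[OF f] peval_combination[OF f])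
qed

text \<open>A dimension bound by counting: \<open>a *s v + b *s w + y\<close> determines
  \<open>a\<close> and \<open>b\<close> by pairing with \<open>w\<close> and \<open>v\<close>, hence
  also \<open>y\<close>, and there are only \<open>CARD('a) ^ 4\<close> vectors.\<close>

lemma card_hyperbolic_complement:
  fixes f :: "('a::{field,finite}) poly4"
  assumes f: "f \<in> forms2" and vw: "peval f v = 0" "peval f w = 0" "polar f v w = 1"
  shows "card {y. polar f v y = 0 \<and> polar f w y = 0} \<le> (CARD('a))\<^sup>2"
proof -
  define W where "W = {y. polar f v y = 0 \<and> polar f w y = 0}"
  let ?h = "\<lambda>(a, b, y). a *s v + b *s w + y"
  have "inj_on ?h (UNIV \<times> UNIV \<times> W)"
  proof (rule inj_onI)
    fix p p'
    assume asm: "p \<in> UNIV \<times> UNIV \<times> W" "p' \<in> UNIV \<times> UNIV \<times> W" "?h p = ?h p'"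
    obtain a b y a' b' y' where p: "p = (a, b, y)" "p' = (a', b', y')"
      by (cases p; cases p')
    from asm have y: "y \<in> W" "y' \<in> W" and eq: "a *s v + b *s w + y = a' *s v + b' *s w + y'"
      by (auto simp: p)
    have coord: "polar f w (a *s v + b *s w + y) = a" "polar f v (a *s v + b *s w + y) = b"
      if "y \<in> W" for a b y
      using that vw unfolding polar_add_right[OF f] polar_scale_right[OF f] polar_self[OF f]
      by (simp_all add: W_def polar_commute)
    from coord[OF y(1), of a b] coord[OF y(2), of a' b'] eq have "a = a'" "b = b'"
      by auto
    with eq show "p = p'"
      by (simp add: p)
  qed
  then have "card (UNIV \<times> UNIV \<times> W :: ('a \<times> 'a \<times> _) set) \<le> card (UNIV :: ('a ^ 4) set)"
    by (rule card_inj_on_le) auto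
  then have "CARD('a) * CARD('a) * card W \<le> CARD('a) * CARD('a) * (CARD('a))\<^sup>2"
    by (simp add: card_cartesian_product power2_eq_square power4_eq_xxxx mult_ac)
  then show ?thesis
    unfolding W_def by (simp only: mult_le_cancel1 nat_0_less_mult_iff zero_less_card_finite)
qed

text \<open>A zero \<open>a *s v + b *s w + y\<close> satisfies \<open>a * b = - peval f y\<close>.
  If \<open>a\<close> is nonzero, then \<open>a\<close> and \<open>y\<close> determine
  \<open>b\<close>. If \<open>a = 0\<close>, anisotropy gives \<open>y = 0\<close> and leaves the
  multiples of \<open>w\<close>.\<close>

lemma anisotropic_complement_card:
  fixes f :: "('a::{field,finite}) poly4"
  assumes f: "f \<in> forms2" and vw: "peval f v = 0" "peval f w = 0" "polar f v w = 1"
    and an: "\<And>y. polar f v y = 0 \<Longrightarrow> polar f w y = 0 \<Longrightarrow> peval f y = 0 \<Longrightarrow> y = 0"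
  shows "card {x. peval f x = 0} \<le> (CARD('a) - 1) * (CARD('a))\<^sup>2 + CARD('a)"
proof -
  define W where "W = {y. polar f v y = 0 \<and> polar f w y = 0}"
  let ?S = "(\<lambda>(a, y). a *s v + (- peval f y / a) *s w + y) ` ((UNIV - {0}) \<times> W)"
  have "{x. peval f x = 0} \<subseteq> ?S \<union> range (\<lambda>b. b *s w)"
  proof
    fix x assume "x \<in> {x. peval f x = 0}"
    then have x: "peval f x = 0"
      by simp
    define a b where "a = polar f x w" and "b = polar f x v"
    obtain y where y: "x = a *s v + b *s w + y" "polar f v y = 0" "polar f w y = 0"
      unfolding a_def b_def by (rule hyperbolic_decomposition[OF f vw])
    have 0: "a * b + peval f y = 0"
      using x unfolding y(1) peval_hyperbolic_sum[OF f vw y(2,3)] .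
    show "x \<in> ?S \<union> range (\<lambda>b. b *s w)"
    proof (cases "a = 0")
      case True
      with 0 an[OF y(2,3)] have "y = 0"
        by simp
      with True y(1) have "x = b *s w"
        by simp
      then show ?thesis
        by blast
    next
      case False
      moreover have "b * a = - peval f y"
        using 0 by (metis eq_neg_iff_add_eq_0 mult.commute)
      ultimately have "b = - peval f y / a"
        by (metis nonzero_eq_divide_eq)
      with y(1) have "x = (\<lambda>(a, y). a *s v + (- peval f y / a) *s w + y) (a, y)"
        by simp
      moreover have "(a, y) \<in> (UNIV - {0}) \<times> W"
        using False y by (simp add: W_def)
      ultimately have "x \<in> ?S"
        by (rule image_eqI)
      then show ?thesis
        by (rule UnI1)
    qed
  qed
  then have "card {x. peval f x = 0} \<le> card (?S \<union> range (\<lambda>b. b *s w))"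
    by (rule card_mono[rotated]) simp
  also have "\<dots> \<le> card ?S + card (range (\<lambda>b. b *s w))"
    by (rule card_Un_le)
  also have "\<dots> \<le> (CARD('a) - 1) * (CARD('a))\<^sup>2 + CARD('a)"
  proof (rule add_mono)
    have "card ?S \<le> card ((UNIV - {0 :: 'a}) \<times> W)"
      by (rule card_image_le) simp
    also have "\<dots> = (CARD('a) - 1) * card W"
      by (simp add: card_cartesian_product)
    also have "\<dots> \<le> (CARD('a) - 1) * (CARD('a))\<^sup>2"
      unfolding W_def by (rule mult_le_mono2[OF card_hyperbolic_complement[OF f vw]])
    finally show "card ?S \<le> (CARD('a) - 1) * (CARD('a))\<^sup>2" .
  qed (rule card_image_le, simp)
  finally show ?thesis .
qed

text \<open>The facts \<open>sum_4\<close> and \<open>forall_4\<close> list the indices as 1, 2, 3,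
  4, and arithmetic in the type \<open>4\<close> is modulo 4.\<close>

lemma four_eq_zero: "(4 :: 4) = 0"
  by simp

lemma sum_UNIV_4: "sum f (UNIV :: 4 set) = f 0 + f 1 + f 2 + f 3"
  unfolding sum_4 four_eq_zero by (simp only: ac_simps)

lemma all_4: "(\<forall>i::4. P i) \<longleftrightarrow> P 0 \<and> P 1 \<and> P 2 \<and> P 3"
  unfolding forall_4 four_eq_zero by blast

definition columns4 :: "'a ^ 4 \<Rightarrow> 'a ^ 4 \<Rightarrow> 'a ^ 4 \<Rightarrow> 'a ^ 4 \<Rightarrow> 'a ^ 4 ^ 4" where
  "columns4 a b c d = (\<chi> i j. if j = 0 then a $ i else if j = 1 then b $ i
     else if j = 2 then c $ i else d $ i)"

lemma columns4_mult:
  fixes a b c d :: "'a::comm_ring_1 ^ 4"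
  shows "columns4 a b c d *v x = x $ 0 *s a + x $ 1 *s b + x $ 2 *s c + x $ 3 *s d"
  by (simp add: vec_eq_iff columns4_def matrix_vector_mult_def sum_UNIV_4 mult_ac)

text \<open>A first hyperbolic pair \<open>v\<close>, \<open>w\<close> comes from any zero. The
  number of points forces a nonzero zero \<open>v'\<close> orthogonal to both, and a partner
  \<open>w'\<close> found in the same complement gives a second pair.\<close>

lemma hyperbolic_quadric_normal_form:
  fixes f :: "('a::{field,finite}) poly4"
  assumes f: "f \<in> forms2" "form_rank f = 4" "card (zero_set f) = (CARD('a) + 1)\<^sup>2"
  obtains A :: "'a ^ 4 ^ 4" where "invertible A" "\<And>x. peval f (A *v x) = x $ 0 * x $ 3 - x $ 1 * x $ 2"
proof -
  note add_simps = polar_add_right[OF f(1)] polar_scale_right[OF f(1)] polar_self[OF f(1)]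
  \<comment> \<open>Here \<open>q\<close> is the order of the field minus 2, so that no truncated
    subtraction remains in the count below.\<close>
  obtain q where q: "CARD('a) = Suc (Suc q)"
  proof -
    have "card {0, 1 :: 'a} \<le> CARD('a)"
      by (rule card_mono) auto
    then show ?thesis
      using that[of "CARD('a) - 2"] by simp
  qed
  have "card (zero_set f) \<noteq> 0"
    using f(3) by simp
  then obtain v where "v \<in> zero_set f"
    by fastforce
  then have v: "v \<noteq> 0" "peval f v = 0"
    by (auto simp: zero_set_def pg3_def)
  obtain u where "polar f v u \<noteq> 0"
    by (rule form_rank_4_radical[OF f(1,2) v])
  from hyperbolic_partner[OF f(1) v(2) this] obtain w where w: "peval f w = 0" "polar f v w = 1"
    by blast
  have "\<exists>y. polar f v y = 0 \<and> polar f w y = 0 \<and> peval f y = 0 \<and> y \<noteq> 0"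
  proof (rule ccontr)
    assume "\<not> ?thesis"
    then have le: "card {x. peval f x = 0} \<le> (CARD('a) - 1) * (CARD('a))\<^sup>2 + CARD('a)"
      by (intro anisotropic_complement_card[OF f(1) v(2) w]) auto
    have "card {x. x \<noteq> 0 \<and> peval f x = 0} = (CARD('a) - 1) * (CARD('a) + 1)\<^sup>2"
      using pg3_cone_card[of "\<lambda>x. peval f x = 0"] f by (simp add: peval_scale zero_set_def)
    moreover have "card {x. x \<noteq> 0 \<and> peval f x = 0} \<le> card {x. peval f x = 0}"
      by (rule card_mono) auto
    ultimately have "(CARD('a) - 1) * (CARD('a) + 1)\<^sup>2 \<le> (CARD('a) - 1) * (CARD('a))\<^sup>2 + CARD('a)"
      using le by linarith
    then have "(q + 1) * (q + 3)\<^sup>2 \<le> (q + 1) * (q + 2)\<^sup>2 + (q + 2)"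
      unfolding q by (simp add: eval_nat_numeral)
    \<comment> \<open>The surplus \<open>(q + 1) * (2 * q + 5)\<close> exceeds the available
      \<open>q + 2\<close>.\<close>
    moreover have "(q + 1) * (q + 3)\<^sup>2 = (q + 1) * (q + 2)\<^sup>2 + (q + 1) * (2 * q + 5)"
      by (simp add: power2_eq_square algebra_simps)
    ultimately show False
      by simp
  qed
  then obtain v' where v': "polar f v v' = 0" "polar f w v' = 0" "peval f v' = 0" "v' \<noteq> 0"
    by blast
  obtain u' where u': "polar f v' u' \<noteq> 0"
    by (rule form_rank_4_radical[OF f(1,2) v'(4,3)])
  obtain y where y: "u' = polar f u' w *s v + polar f u' v *s w + y" "polar f v y = 0" "polar f w y = 0"
    by (rule hyperbolic_decomposition[OF f(1) v(2) w])
  have "polar f v' v = 0" "polar f v' w = 0"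
    using v'(1,2) by (simp_all only: polar_commute[of f v'])
  \<comment> \<open>As \<open>v'\<close> is orthogonal to \<open>v\<close> and \<open>w\<close>,
    projecting \<open>u'\<close> to the complement keeps its pairing with \<open>v'\<close>.\<close>
  then have "polar f v' u' = polar f v' y"
    by (subst y(1)) (simp only: add_simps mult_zero_right add_0)
  with u' have "polar f v' y \<noteq> 0"
    by simp
  then obtain c d where "peval f (c *s y + d *s v') = 0" "polar f v' (c *s y + d *s v') = 1"
    by (rule hyperbolic_partner[OF f(1) v'(3)])
  moreover define w' where "w' = c *s y + d *s v'"
  ultimately have w': "peval f w' = 0" "polar f v' w' = 1" "polar f v w' = 0" "polar f w w' = 0"
    using y v' by (simp_all add: add_simps)
  \<comment> \<open>The two pairs occupy the positions 0, 3 and 1, 2; negating \<open>w'\<close>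
    produces the minus sign of the normal form.\<close>
  define A where "A = columns4 v v' (- w') w"
  have Ax: "A *v x = x $ 0 *s v + x $ 3 *s w + (x $ 1 *s v' + (- x $ 2) *s w')" for x
    by (simp add: A_def columns4_mult vec_eq_iff)
  show ?thesis
  proof (rule that[of A])
    show "peval f (A *v x) = x $ 0 * x $ 3 - x $ 1 * x $ 2" for x
      unfolding Ax using v' w'
      by (subst peval_hyperbolic_sum[OF f(1) v(2) w])
        (simp_all only: add_simps peval_combination[OF f(1)], simp_all)
    show "invertible A"
    proof (rule invertible_if_injective)
      fix x assume 0: "A *v x = 0"
      \<comment> \<open>This is \<open>polar f z 0 = 0\<close>, with the zero vector written as a
        multiple so that linearity applies.\<close>
      have "polar f z (0 *s 0) = 0" for z
        by (simp only: add_simps mult_zero_left)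
      then have "polar f z (A *v x) = 0" for z
        by (simp add: 0)
      \<comment> \<open>Pairing with a member of either pair isolates the coordinate of its partner,
        up to sign.\<close>
      from this[of w] this[of v] this[of w'] this[of v']
      have "x $ 0 = 0" "x $ 3 = 0" "x $ 1 = 0" "x $ 2 = 0"
        unfolding Ax add_simps using v v' w w'
        by (simp_all add: polar_commute[of f w v] polar_commute[of f v' v] polar_commute[of f v' w]
            polar_commute[of f w' v] polar_commute[of f w' w] polar_commute[of f w' v'])
      then show "x = 0"
        by (simp add: vec_eq_iff all_4)
    qed
  qed
qed

section \<open>Points on a grid\<close>

text \<open>A line of the grid is full or has at most two zeros. Three full rows put three zeros in
  every column and so fill the grid, and likewise for columns; the remaining cases are counted along
  rows or along columns.\<close>

lemma card_grid_zeros: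
  fixes Z :: "('r::finite \<times> 'r) set"
  assumes q: "CARD('r) = q + 1" "q \<ge> 1"
    and rows: "\<And>s. card {t. (s, t) \<in> Z} \<ge> 3 \<Longrightarrow> {t. (s, t) \<in> Z} = UNIV"
    and cols: "\<And>t. card {s. (s, t) \<in> Z} \<ge> 3 \<Longrightarrow> {s. (s, t) \<in> Z} = UNIV"
  shows "Z = UNIV \<or> card Z = 4 * q \<or> card Z \<le> 3 * q + 1"
proof -
  define row where "row s = {t. (s, t) \<in> Z}" for s
  define col where "col t = {s. (s, t) \<in> Z}" for t
  define R where "R = {s. row s = UNIV}"
  define C where "C = {t. col t = UNIV}"
  have full: "Z = UNIV" if "card R \<ge> 3 \<or> card C \<ge> 3"
  proof -
    have "card R \<le> card (col t)" for t
      by (rule card_mono) (auto simp: R_def row_def col_def)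
    moreover have "card C \<le> card (row s)" for s
      by (rule card_mono) (auto simp: C_def row_def col_def)
    ultimately have "(\<forall>t. card (col t) \<ge> 3) \<or> (\<forall>s. card (row s) \<ge> 3)"
      using that le_trans by blast
    then have "(\<forall>t. col t = UNIV) \<or> (\<forall>s. row s = UNIV)"
      using rows cols by (auto simp: row_def col_def)
    then show ?thesis
      by (auto simp: row_def col_def)
  qed
  have card_rows: "card Z = (\<Sum>s\<in>R. card (row s)) + (\<Sum>s\<in>-R. card (row s))"
  proof -
    have "Z = Sigma UNIV row"
      by (auto simp: row_def)
    then have "card Z = (\<Sum>s\<in>UNIV. card (row s))"
      by (metis card_SigmaI finite)
    then show ?thesis
      by (simp add: sum.subset_diff[of R UNIV] Compl_eq_Diff_UNIV add.commute)
  qed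
  have card_cols: "card Z = (\<Sum>t\<in>C. card (col t)) + (\<Sum>t\<in>-C. card (col t))"
  proof -
    have "Z = prod.swap ` Sigma UNIV col"
      by (auto simp: col_def)
    then have "card Z = (\<Sum>t\<in>UNIV. card (col t))"
      by (metis card_SigmaI card_image finite inj_swap)
    then show ?thesis
      by (simp add: sum.subset_diff[of C UNIV] Compl_eq_Diff_UNIV add.commute)
  qed
  have sumR: "(\<Sum>s\<in>R. card (row s)) = card R * (q + 1)"
    by (simp add: R_def q)
  have sumC: "(\<Sum>t\<in>C. card (col t)) = card C * (q + 1)"
    by (simp add: C_def q)
  have compl: "card (-S) + card S = q + 1" for S :: "'r set"
    using card_Un_disjoint[of "-S" S] by (simp add: q)
  note cR = compl[of R] and cC = compl[of C]
  consider "card R \<ge> 3 \<or> card C \<ge> 3" | "card R \<le> 1" | "card R = 2" "card C \<le> 2"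
    by linarith
  then show ?thesis
  proof cases
    case 1
    then show ?thesis
      using full by blast
  next
    case 2
    have "(\<Sum>s\<in>-R. card (row s)) \<le> (\<Sum>s\<in>-R. 2)"
    proof (rule sum_mono)
      fix s assume "s \<in> - R"
      then have "\<not> card (row s) \<ge> 3"
        using rows by (auto simp: R_def row_def)
      then show "card (row s) \<le> 2"
        by linarith
    qed
    \<comment> \<open>One full row gives at most \<open>(q + 1) + 2 * q\<close>, none at most
      \<open>2 * (q + 1)\<close>; the latter is within the bound since
      \<open>q \<ge> 1\<close>.\<close>
    then have "card Z \<le> card R * (q + 1) + 2 * card (-R)"
      by (simp add: card_rows sumR)
    moreover have "card R = 0 \<or> card R = 1"
      using 2 by linarith
    ultimately show ?thesis
      using cR q by auto
  next
    case 3
    \<comment> \<open>The two full rows meet every column, so a column that is not full has exactly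
      two zeros.\<close>
    have "card (col t) = 2" if "t \<in> -C" for t
    proof -
      have "card R \<le> card (col t)"
        by (rule card_mono) (auto simp: R_def row_def col_def)
      moreover have "\<not> card (col t) \<ge> 3"
        using that cols by (auto simp: C_def col_def)
      ultimately show ?thesis
        using 3 by linarith
    qed
    then have "card Z = card C * (q + 1) + 2 * card (-C)"
      by (simp add: card_cols sumC)
    \<comment> \<open>For 0, 1 or 2 full columns the total is \<open>2 * q + 2\<close>,
      \<open>3 * q + 1\<close> or \<open>4 * q\<close>.\<close>
    moreover have "card C = 0 \<or> card C = 1 \<or> card C = 2"
      using 3 by linarith
    ultimately show ?thesis
      using cC q by auto
  qed
qed

text \<open>A point of the projective line is an element of \<open>'a option\<close>: \<open>Some a\<close> stands for
  \<open>(1 : a)\<close> and \<open>None\<close> for \<open>(0 : 1)\<close>.\<close>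

definition hx :: "'a option \<Rightarrow> 'a::field" where
  "hx s = (case s of None \<Rightarrow> 0 | Some a \<Rightarrow> 1)"

definition hy :: "'a option \<Rightarrow> 'a::field" where
  "hy s = (case s of None \<Rightarrow> 1 | Some a \<Rightarrow> a)"

lemma h_simps [simp]: "hx None = 0" "hx (Some a) = 1" "hy None = 1" "hy (Some a) = a"
  by (simp_all add: hx_def hy_def)

section \<open>Binary quadratic forms on the projective line\<close>

lemma three_points_cases:
  assumes "r \<in> S" "s \<in> S" "t \<in> S" "r \<noteq> s" "r \<noteq> t" "s \<noteq> t"
  obtains a b where "None \<in> S" "Some a \<in> S" "Some b \<in> S" "a \<noteq> b"
    | a b c where "Some a \<in> S" "Some b \<in> S" "Some c \<in> S" "a \<noteq> b" "a \<noteq> c" "b \<noteq> c"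
  using assms by (cases r; cases s; cases t) blast+

text \<open>Three zeros force all coefficients to vanish. A zero at infinity gives
  \<open>\<gamma> = 0\<close> and leaves a linear polynomial with two roots; three finite zeros are
  handled by repeated divided differences.\<close>

lemma binary_quadratic_zeros:
  fixes \<alpha> \<beta> \<gamma> :: "'a::{field,finite}"
  assumes "card {t. (hx t)\<^sup>2 * \<alpha> + hx t * hy t * \<beta> + (hy t)\<^sup>2 * \<gamma> = 0} \<ge> 3"
  shows "{t. (hx t)\<^sup>2 * \<alpha> + hx t * hy t * \<beta> + (hy t)\<^sup>2 * \<gamma> = 0} = UNIV"
proof -
  let ?S = "{t. (hx t)\<^sup>2 * \<alpha> + hx t * hy t * \<beta> + (hy t)\<^sup>2 * \<gamma> = 0}"
  obtain T where T: "T \<subseteq> ?S" "card T = 3"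
    by (rule obtain_subset_with_card_n[OF assms])
  from T(2) obtain r s t where "T = {r, s, t}" and ne: "r \<noteq> s" "r \<noteq> t" "s \<noteq> t"
    unfolding card_3_iff by blast
  with T(1) have rst: "r \<in> ?S" "s \<in> ?S" "t \<in> ?S"
    by (simp_all only: insert_subset)
  have two: "\<alpha> = 0 \<and> \<beta> = 0" if "\<alpha> + a * \<beta> = 0" "\<alpha> + b * \<beta> = 0" "a \<noteq> b" for a b
  proof -
    have "(a - b) * \<beta> = (\<alpha> + a * \<beta>) - (\<alpha> + b * \<beta>)"
      by (simp add: algebra_simps)
    with that show ?thesis
      by simp
  qed
  have three: "\<alpha> = 0 \<and> \<beta> = 0 \<and> \<gamma> = 0"
    if z: "\<alpha> + a * \<beta> + a\<^sup>2 * \<gamma> = 0" "\<alpha> + b * \<beta> + b\<^sup>2 * \<gamma> = 0" "\<alpha> + c * \<beta> + c\<^sup>2 * \<gamma> = 0"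
      and "a \<noteq> b" "a \<noteq> c" "b \<noteq> c" for a b c
  proof -
    have 1: "\<beta> + (x + y) * \<gamma> = 0"
      if "x \<noteq> y" "\<alpha> + x * \<beta> + x\<^sup>2 * \<gamma> = 0" "\<alpha> + y * \<beta> + y\<^sup>2 * \<gamma> = 0" for x y
    proof -
      \<comment> \<open>The difference of the two values is divisible by \<open>x - y\<close>, which
        lowers the degree by one.\<close>
      have "(x - y) * (\<beta> + (x + y) * \<gamma>) = (\<alpha> + x * \<beta> + x\<^sup>2 * \<gamma>) - (\<alpha> + y * \<beta> + y\<^sup>2 * \<gamma>)"
        by (simp add: algebra_simps power2_eq_square)
      also have "\<dots> = 0"
        by (simp only: that diff_self)
      finally show ?thesis
        using \<open>x \<noteq> y\<close> by (simp only: mult_eq_0_iff right_minus_eq) blast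
    qed
    have "(b - c) * \<gamma> = (\<beta> + (a + b) * \<gamma>) - (\<beta> + (a + c) * \<gamma>)"
      by (simp add: algebra_simps)
    also have "\<dots> = 0"
      by (simp only: 1[OF \<open>a \<noteq> b\<close> z(1,2)] 1[OF \<open>a \<noteq> c\<close> z(1,3)] diff_self)
    finally have "\<gamma> = 0"
      using \<open>b \<noteq> c\<close> by simp
    with 1[OF \<open>a \<noteq> b\<close> z(1,2)] z(1) show ?thesis
      by simp
  qed
  have zero: "None \<in> ?S \<longleftrightarrow> \<gamma> = 0" "Some a \<in> ?S \<longleftrightarrow> \<alpha> + a * \<beta> + a\<^sup>2 * \<gamma> = 0" for a
    by simp_all
  from rst ne have "\<alpha> = 0 \<and> \<beta> = 0 \<and> \<gamma> = 0"
  proof (cases rule: three_points_cases)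
    case (1 a b)
    then have "\<gamma> = 0" "\<alpha> + a * \<beta> = 0" "\<alpha> + b * \<beta> = 0"
      unfolding zero by simp_all
    with two[of a b] \<open>a \<noteq> b\<close> show ?thesis
      by blast
  next
    case (2 a b c)
    then show ?thesis
      unfolding zero by (rule three)
  qed
  then show ?thesis
    by simp
qed

text \<open>Both factors have first nonzero coordinate 1, and so has their product vector: the image
  lies in \<open>pg3\<close> without rescaling.\<close>

definition segre :: "'a option \<Rightarrow> 'a option \<Rightarrow> ('a::field) ^ 4" where
  "segre s t = (\<chi> i. if i = 0 then hx s * hx t else if i = 1 then hx s * hy t
     else if i = 2 then hy s * hx t else hy s * hy t)"

lemma segre_nth [simp]:
  "segre s t $ 0 = hx s * hx t" "segre s t $ 1 = hx s * hy t"
  "segre s t $ 2 = hy s * hx t" "segre s t $ 3 = hy s * hy t"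
  by (simp_all add: segre_def)

lemma pg3_iff:
  "x \<in> pg3 \<longleftrightarrow> x $ 0 = 1 \<or> x $ 0 = 0 \<and> x $ 1 = 1 \<or> x $ 0 = 0 \<and> x $ 1 = 0 \<and> x $ 2 = 1
     \<or> x $ 0 = 0 \<and> x $ 1 = 0 \<and> x $ 2 = 0 \<and> x $ 3 = 1"
proof -
  have "(0::4) < 1" "(0::4) < 2" "(0::4) < 3" "(1::4) < 2" "(1::4) < 3" "(2::4) < 3"
    by (simp_all add: less_bit0_def bit0.Rep_0 bit0.Rep_1 bit0.Rep_numeral)
  then have less: "(0::4) < 1" "(0::4) < 2" "(0::4) < 3" "(1::4) < 2" "(1::4) < 3" "(2::4) < 3"
    "\<not> (1::4) < 0" "\<not> (2::4) < 0" "\<not> (3::4) < 0" "\<not> (2::4) < 1" "\<not> (3::4) < 1" "\<not> (3::4) < 2"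
    by (simp_all only: not_less less_imp_le)
  have ex: "(\<exists>i::4. P i) \<longleftrightarrow> P 0 \<or> P 1 \<or> P 2 \<or> P 3" for P
    using all_4[of "\<lambda>i. \<not> P i"] by blast
  show ?thesis
    unfolding pg3_def mem_Collect_eq ex all_4 by (simp only: less less_irrefl simp_thms) blast
qed

lemma bij_betw_segre:
  "bij_betw (\<lambda>(s, t). segre s t) UNIV {x \<in> pg3. x $ 0 * x $ 3 - x $ 1 * x $ 2 = (0 :: 'a::field)}"
  unfolding bij_betw_def
proof
  show "inj (\<lambda>(s, t). segre s t :: 'a ^ 4)"
  proof (rule injI, clarify)
    fix s t s' t' :: "'a option"
    assume "segre s t = segre s' t'"
    then have "segre s t $ i = segre s' t' $ i" for i
      by simp
    from this[of 0] this[of 1] this[of 2] this[of 3] show "s = s' \<and> t = t'"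
      by (cases s; cases t; cases s'; cases t') auto
  qed
  show "range (\<lambda>(s, t). segre s t) = {x \<in> pg3. x $ 0 * x $ 3 - x $ 1 * x $ 2 = (0 :: 'a)}"
  proof (intro equalityI subsetI)
    fix x :: "'a ^ 4" assume "x \<in> range (\<lambda>(s, t). segre s t)"
    then obtain s t where "x = segre s t"
      by auto
    then show "x \<in> {x \<in> pg3. x $ 0 * x $ 3 - x $ 1 * x $ 2 = 0}"
      by (cases s; cases t) (simp_all add: pg3_iff)
  next
    fix x :: "'a ^ 4" assume "x \<in> {x \<in> pg3. x $ 0 * x $ 3 - x $ 1 * x $ 2 = 0}"
    then have x: "x \<in> pg3" "x $ 0 * x $ 3 = x $ 1 * x $ 2"
      by auto
    \<comment> \<open>The position of the leading 1 tells which of \<open>s\<close> and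
      \<open>t\<close> are finite. The finite parameters are \<open>x $ 2\<close> and
      \<open>x $ 1\<close> if both are finite, and \<open>x $ 3\<close> if just one is.\<close>
    define s where "s = (if x $ 0 = 1 then Some (x $ 2) else if x $ 1 = 1 then Some (x $ 3) else None)"
    define t where "t = (if x $ 0 = 1 then Some (x $ 1) else if x $ 1 = 1 then None
      else if x $ 2 = 1 then Some (x $ 3) else None)"
    have "x = segre s t"
      using x by (auto simp: s_def t_def pg3_iff vec_eq_iff all_4)
    then have "x = (\<lambda>(s, t). segre s t) (s, t)"
      by simp
    then show "x \<in> range (\<lambda>(s, t). segre s t)"
      by (rule image_eqI) simp
  qed
qed

section \<open>Weights\<close>

definition grid_weight :: "('a::field) poly4 \<Rightarrow> nat" where
  "grid_weight g = card {(s, t). peval g (segre s t) \<noteq> 0}"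

text \<open>On each row and each column \<open>g\<close> restricts to a binary quadratic form, so
  \<open>card_grid_zeros\<close> applies to its zeros. The weight counts the complement in a grid of
  \<open>(q + 1)\<^sup>2\<close> points.\<close>

lemma grid_weight_cases:
  fixes g :: "('a::{field,finite}) poly4"
  assumes g: "g \<in> forms2" and q: "q = CARD('a)"
  shows "grid_weight g = 0 \<or> grid_weight g + 4 * q = (q + 1)\<^sup>2 \<or> grid_weight g + (3 * q + 1) \<ge> (q + 1)\<^sup>2"
proof -
  define Z where "Z = {(s, t). peval g (segre s t) = 0}"
  \<comment> \<open>Every line of either ruling is spanned by its points with parameters
    \<open>Some 0\<close> and \<open>None\<close>.\<close>
  have row: "segre s t = hx t *s segre s (Some 0) + hy t *s segre s None" for s t :: "'a option"
    by (simp add: vec_eq_iff all_4)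
  have col: "segre s t = hx s *s segre (Some 0) t + hy s *s segre None t" for s t :: "'a option"
    by (simp add: vec_eq_iff all_4)
  have CARD: "CARD('a option) = q + 1"
    by (simp add: q card_UNIV_option)
  have "Z = UNIV \<or> card Z = 4 * q \<or> card Z \<le> 3 * q + 1"
  proof (rule card_grid_zeros[OF CARD])
    show "q \<ge> 1"
      by (simp add: q Suc_le_eq)
    have iff: "(s, t) \<in> Z \<longleftrightarrow> peval g (segre s t) = 0" for s t
      by (simp add: Z_def)
    show "{t. (s, t) \<in> Z} = UNIV" if "card {t. (s, t) \<in> Z} \<ge> 3" for s
    proof -
      let ?E = "\<lambda>t. (hx t)\<^sup>2 * peval g (segre s (Some 0)) + hx t * hy t * polar g (segre s (Some 0)) (segre s None)
        + (hy t)\<^sup>2 * peval g (segre s None)"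
      have eq: "{t. (s, t) \<in> Z} = {t. ?E t = 0}"
        unfolding iff
        by (intro Collect_cong arg_cong[where f = "\<lambda>x. x = 0"])
          (rule trans[OF arg_cong[where f = "peval g", OF row] peval_combination[OF g]])
      show ?thesis
        using that unfolding eq by (rule binary_quadratic_zeros)
    qed
    show "{s. (s, t) \<in> Z} = UNIV" if "card {s. (s, t) \<in> Z} \<ge> 3" for t
    proof -
      let ?E = "\<lambda>s. (hx s)\<^sup>2 * peval g (segre (Some 0) t) + hx s * hy s * polar g (segre (Some 0) t) (segre None t)
        + (hy s)\<^sup>2 * peval g (segre None t)"
      have eq: "{s. (s, t) \<in> Z} = {s. ?E s = 0}"
        unfolding iff
        by (intro Collect_cong arg_cong[where f = "\<lambda>x. x = 0"])
          (rule trans[OF arg_cong[where f = "peval g", OF col] peval_combination[OF g]])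
      show ?thesis
        using that unfolding eq by (rule binary_quadratic_zeros)
    qed
  qed
  moreover have "card Z + grid_weight g = (q + 1)\<^sup>2"
  proof -
    have "{(s, t). peval g (segre s t) \<noteq> 0} = - Z"
      by (auto simp: Z_def)
    moreover have "card Z + card (- Z) = card (UNIV :: ('a option \<times> 'a option) set)"
      by (subst card_Un_disjoint[symmetric]) (auto simp: Un_commute)
    ultimately show ?thesis
      by (simp add: grid_weight_def card_UNIV_option q power2_eq_square)
  qed
  moreover have "grid_weight g = 0" if "Z = UNIV"
    using that by (auto simp: grid_weight_def Z_def)
  ultimately show ?thesis
    by linarith
qed

text \<open>The matrix \<open>A\<close> does not map normalised vectors to normalised ones. The
  comparison is therefore made between nonzero vectors, and the common factor
  \<open>CARD('a) - 1\<close> is cancelled afterwards.\<close>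

lemma word_weight_eq_grid_weight:
  fixes f g :: "('a::{field,finite}) poly4" and A :: "'a ^ 4 ^ 4"
  assumes f: "f \<in> forms2" and g: "g \<in> forms2" and A: "invertible A"
    and nf: "\<And>x. peval f (A *v x) = x $ 0 * x $ 3 - x $ 1 * x $ 2"
  shows "word_weight (zero_set f) (restrict (peval g) (zero_set f)) = grid_weight (lin_subst A g)"
proof -
  let ?P = "\<lambda>x. peval f x = 0 \<and> peval g x \<noteq> 0"
  let ?P' = "\<lambda>x. ?P (A *v x)"
  have "CARD('a) \<ge> 2"
    using card_mono[of UNIV "{0, 1 :: 'a}"] by simp
  then have pos: "CARD('a) - 1 > 0"
    by simp
  obtain B where B: "A ** B = mat 1" "B ** A = mat 1"
    using A by (auto simp: invertible_def)
  have inv: "A *v (B *v x) = x" "B *v (A *v x) = x" for x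
    using B by (simp_all add: matrix_vector_mul_assoc)
  have nz: "A *v x = 0 \<longleftrightarrow> x = 0" "B *v x = 0 \<longleftrightarrow> x = 0" for x
    by (metis inv matrix_vector_mult_0_right)+
  have "bij_betw (\<lambda>x. A *v x) {x. x \<noteq> 0 \<and> ?P' x} {x. x \<noteq> 0 \<and> ?P x}"
    by (rule bij_betw_byWitness[where f' = "\<lambda>x. B *v x"])
      (auto simp: inv nz)
  then have "card {x. x \<noteq> 0 \<and> ?P' x} = card {x. x \<noteq> 0 \<and> ?P x}"
    by (rule bij_betw_same_card)
  moreover have "card {x. x \<noteq> 0 \<and> ?P x} = (CARD('a) - 1) * card {x \<in> pg3. ?P x}"
    by (rule pg3_cone_card) (simp add: peval_scale f g)
  moreover have "card {x. x \<noteq> 0 \<and> ?P' x} = (CARD('a) - 1) * card {x \<in> pg3. ?P' x}"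
    by (rule pg3_cone_card) (simp add: vector_scalar_commute peval_scale f g)
  ultimately have "card {x \<in> pg3. ?P x} = card {x \<in> pg3. ?P' x}"
    using pos by simp
  also have "\<dots> = grid_weight (lin_subst A g)"
  proof -
    let ?h = "\<lambda>(s, t). segre s t :: 'a ^ 4"
    have inj: "inj ?h" and img: "range ?h = {x \<in> pg3. x $ 0 * x $ 3 - x $ 1 * x $ 2 = 0}"
      using bij_betw_segre[where 'a = 'a] by (simp_all only: bij_betw_def)
    have "{x \<in> pg3. ?P' x} = {x \<in> range ?h. peval (lin_subst A g) x \<noteq> 0}"
      unfolding img by (auto simp: nf peval_lin_subst)
    also have "\<dots> = ?h ` {(s, t). peval (lin_subst A g) (segre s t) \<noteq> 0}"
      by auto
    finally have "{x \<in> pg3. ?P' x} = ?h ` {(s, t). peval (lin_subst A g) (segre s t) \<noteq> 0}" .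
    moreover have "inj_on ?h {(s, t). peval (lin_subst A g) (segre s t) \<noteq> 0}"
      using inj by (rule inj_on_subset) simp
    ultimately show ?thesis
      unfolding grid_weight_def by (simp add: card_image)
  qed
  also have "card {x \<in> pg3. ?P x} = word_weight (zero_set f) (restrict (peval g) (zero_set f))"
    unfolding word_weight_def by (rule arg_cong[where f = card]) (auto simp: zero_set_def)
  finally show ?thesis .
qed

lemma code_weights_eq_grid_weights:
  fixes f :: "('a::{field,finite}) poly4" and A :: "'a ^ 4 ^ 4"
  assumes f: "f \<in> forms2" and A: "invertible A"
    and nf: "\<And>x. peval f (A *v x) = x $ 0 * x $ 3 - x $ 1 * x $ 2"
  shows "code_weights (zero_set f) = grid_weight ` (forms2 :: 'a poly4 set) - {0}"
proof -
  have forms: "lin_subst M g \<in> forms2" if "g \<in> forms2" for M and g :: "'a poly4"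
    using that by (simp add: forms2_iff_homogeneous homogeneous_lin_subst)
  have "word_weight (zero_set f) ` functional_code2 (zero_set f)
      = (\<lambda>g. grid_weight (lin_subst A g)) ` forms2"
    unfolding functional_code2_def image_image
    by (intro image_cong refl word_weight_eq_grid_weight assms)
  also have "\<dots> = grid_weight ` (forms2 :: 'a poly4 set)"
  proof (intro equalityI subsetI)
    fix n assume "n \<in> grid_weight ` (forms2 :: 'a poly4 set)"
    then obtain h :: "'a poly4" where h: "h \<in> forms2" "n = grid_weight h"
      by auto
    obtain B where B: "B ** A = mat 1"
      using A by (auto simp: invertible_def)
    \<comment> \<open>A weight depends only on values, so it suffices that the two matrices cancel;
      the polynomials need not be compared.\<close>
    have "grid_weight (lin_subst A (lin_subst B h)) = n"
      by (simp add: h grid_weight_def peval_lin_subst matrix_vector_mul_assoc B)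
    then show "n \<in> (\<lambda>g. grid_weight (lin_subst A g)) ` forms2"
      using forms[OF h(1), of B] by blast
  qed (use forms in blast)
  finally show ?thesis
    by (simp add: code_weights_def)
qed

text \<open>On the grid the three zero sets are two rows with two columns, two rows with one column,
  and a row, a column and the diagonal.\<close>

lemma grid_weight_examples:
  fixes q :: nat
  assumes q: "q = CARD('a::{field,finite})"
  shows "(q - 1) * (q - 1) \<in> grid_weight ` (forms2 :: 'a poly4 set)"
    and "q * (q - 1) \<in> grid_weight ` (forms2 :: 'a poly4 set)"
    and "q + (q - 1) * (q - 1) \<in> grid_weight ` (forms2 :: 'a poly4 set)"
proof -
  define X where "X i j = Poly_Mapping.single (Poly_Mapping.single i (1 :: nat) + Poly_Mapping.single j 1) (1 :: 'a)" for i j :: 4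
  have hom: "homogeneous 2 (X i j)" for i j
    unfolding X_def by (rule homogeneous_single) (simp add: total_degree_add)
  then have X: "X i j \<in> forms2" for i j
    by (simp add: forms2_iff_homogeneous)
  have ev: "peval (X i j) v = v $ i * v $ j" for i j v
    by (simp add: X_def monom_val_add)
  let ?U = "UNIV - {0 :: 'a}"
  have cU: "card ?U = q - 1"
    by (simp add: q)
  have "{(s, t). peval (X 0 3) (segre s t) \<noteq> 0} = map_prod Some Some ` (?U \<times> ?U)"
  proof (intro set_eqI, clarify)
    fix s t :: "'a option"
    show "(s, t) \<in> {(s, t). peval (X 0 3) (segre s t) \<noteq> 0} \<longleftrightarrow> (s, t) \<in> map_prod Some Some ` (?U \<times> ?U)"
      by (cases s; cases t) (auto simp: ev)
  qed
  moreover have "inj_on (map_prod Some Some) S" for S :: "('a \<times> 'a) set"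
    by (auto intro: inj_onI)
  ultimately have "grid_weight (X 0 3) = (q - 1) * (q - 1)"
    by (simp add: grid_weight_def card_image card_cartesian_product cU)
  then show "(q - 1) * (q - 1) \<in> grid_weight ` (forms2 :: 'a poly4 set)"
    using X by (metis image_eqI)
  have "{(s, t). peval (X 0 2) (segre s t) \<noteq> 0} = map_prod Some Some ` (?U \<times> UNIV)"
  proof (intro set_eqI, clarify)
    fix s t :: "'a option"
    show "(s, t) \<in> {(s, t). peval (X 0 2) (segre s t) \<noteq> 0} \<longleftrightarrow> (s, t) \<in> map_prod Some Some ` (?U \<times> UNIV)"
      by (cases s; cases t) (auto simp: ev)
  qed
  moreover have "inj_on (map_prod Some Some) S" for S :: "('a \<times> 'a) set"
    by (auto intro: inj_onI)
  ultimately have "grid_weight (X 0 2) = q * (q - 1)"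
    by (simp add: grid_weight_def card_image card_cartesian_product cU q)
  then show "q * (q - 1) \<in> grid_weight ` (forms2 :: 'a poly4 set)"
    using X by (metis image_eqI)
  define g where "g = X 1 1 + Poly_Mapping.single 0 (- 1) * X 1 2"
  have "homogeneous (0 + 2) (Poly_Mapping.single 0 (- 1) * X 1 2)"
    by (intro homogeneous_mult hom homogeneous_single) (simp add: total_degree_def)
  then have g: "g \<in> forms2"
    unfolding g_def forms2_iff_homogeneous add_0 by (rule homogeneous_add[OF hom])
  have evg: "peval g v = v $ 1 * (v $ 1 - v $ 2)" for v
    by (simp add: g_def peval_add peval_mult ev algebra_simps)
  \<comment> \<open>The nonzeros with \<open>t\<close> infinite, where the value is 1, and those at
    \<open>(Some a, Some b)\<close>, where the value is \<open>b * (b - a)\<close>.\<close>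
  let ?S = "(\<lambda>a. (Some a, None)) ` UNIV :: ('a option \<times> 'a option) set"
  let ?T = "(\<lambda>(b, a). (Some a, Some b)) ` (SIGMA b:?U. UNIV - {b})"
  have "{(s, t). peval g (segre s t) \<noteq> 0} = ?S \<union> ?T"
  proof (intro set_eqI, clarify)
    fix s t :: "'a option"
    show "(s, t) \<in> {(s, t). peval g (segre s t) \<noteq> 0} \<longleftrightarrow> (s, t) \<in> ?S \<union> ?T"
      by (cases s; cases t) (auto simp: evg image_iff)
  qed
  moreover have "card (?S \<union> ?T) = card ?S + card ?T"
    by (rule card_Un_disjoint) auto
  moreover have "card ?S = q"
    by (subst card_image) (auto intro: inj_onI simp: q)
  moreover have "card ?T = (q - 1) * (q - 1)"
    by (subst card_image) (auto intro!: inj_onI simp: q)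
  ultimately have "grid_weight g = q + (q - 1) * (q - 1)"
    by (simp add: grid_weight_def)
  with g show "q + (q - 1) * (q - 1) \<in> grid_weight ` (forms2 :: 'a poly4 set)"
    by (metis image_eqI)
qed

theorem theorem6p4:
  fixes X :: "(('a::{field,finite}) ^ 4) set" and q :: nat
  assumes "q = CARD('a)"
    and "q \<ge> 3"
    and "hyperbolic_quadric X"
  shows "is_kth_weight X 2 (q * (q - 1)) \<and> is_kth_weight X 3 (q\<^sup>2 - q + 1)"
proof -
  obtain f where f: "f \<in> forms2" "form_rank f = 4" and X: "X = zero_set f"
    and "card (zero_set f) = (CARD('a) + 1)\<^sup>2"
    using assms(3) by (auto simp: hyperbolic_quadric_def)
  then obtain A :: "'a ^ 4 ^ 4" where "invertible A" "\<And>x. peval f (A *v x) = x $ 0 * x $ 3 - x $ 1 * x $ 2"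
    by (metis hyperbolic_quadric_normal_form)
  then have W: "code_weights X = grid_weight ` (forms2 :: 'a poly4 set) - {0}"
    unfolding X by (rule code_weights_eq_grid_weights[OF f(1)])
  \<comment> \<open>In terms of \<open>p = q - 1\<close> the three smallest weights are
    \<open>p * p\<close>, \<open>p * p + p\<close> and \<open>p * p + p + 1\<close>.\<close>
  obtain p where p: "q = p + 1" "p \<ge> 2"
    using assms(2) by (intro that[of "q - 1"]) auto
  have low: "v = p * p \<or> v \<ge> p * p + p" if v: "v \<in> code_weights X" for v
  proof -
    obtain g :: "'a poly4" where g: "g \<in> forms2" "v = grid_weight g" "v \<noteq> 0"
      using v by (auto simp: W)
    \<comment> \<open>These are the complements of \<open>4 * q\<close> and \<open>3 * q + 1\<close>
      zeros.\<close>
    have "(q + 1)\<^sup>2 = p * p + 4 * q" "(q + 1)\<^sup>2 = p * p + p + (3 * q + 1)"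
      by (simp_all add: p power2_eq_square algebra_simps)
    with grid_weight_cases[OF g(1) assms(1)] g(2,3) show ?thesis
      by linarith
  qed
  have w: "p * p \<in> code_weights X" "p * p + p \<in> code_weights X" "p * p + p + 1 \<in> code_weights X"
    using grid_weight_examples[OF assms(1)] p by (simp_all add: W add_ac)
  have "{v \<in> code_weights X. v < p * p + p} = {p * p}"
    using w p by (auto dest: low)
  \<comment> \<open>The second and third weights are consecutive integers, so nothing can lie
    between them.\<close>
  moreover have "{v \<in> code_weights X. v < p * p + p + 1} = {p * p, p * p + p}"
    using w p by (auto dest: low)
  moreover have weights: "q\<^sup>2 - q + 1 = p * p + p + 1" "q * (q - 1) = p * p + p"
    by (simp_all add: p power2_eq_square algebra_simps)
  ultimately show ?thesis
    using w p(2) unfolding is_kth_weight_def weights by (simp only:) simp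
qed

end
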